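(* For a morphism $\varphi:S\to T$ in $\mathsf{CRig}_z$, the assignment $\mathrm{ZId}(\varphi)(I)=\bigvee^{z}_{a\in I}\langle\varphi(a)\rangle_z$ (join in $\mathrm{ZId}(T)$) defines a coherent frame homomorphism $\mathrm{ZId}(S)\to\mathrm{ZId}(T)$. Thus $\mathrm{ZId}:\mathsf{CRig}_z\to\mathsf{CohFrm}$ is a functor.
   Context: A semiring here is commutative with $0$ and $1$: $(S,+,0)$ and $(S,\cdot,1)$ are commutative monoids, multiplication distributes over addition, and $0s=0$; homomorphisms preserve $0$ and $1$. An ideal is a non-empty subset closed under addition and under multiplication by arbitrary elements; maximal ideals are proper. With $\mathcal M(a)$ the set of maximal ideals containing $a$, an ideal $I$ is a $z$-ideal if $a\in I$ and $\mathcal M(a)=\mathcal M(b)$ imply $b\in I$. $\mathfrak{cl}_z(I)$ is the intersection of all $z$-ideals containing $I$, and $\langle a\rangle_z=\mathfrak{cl}_z(\langle a\rangle)$. $\mathrm{ZId}(S)$ is the set of $z$-ideals of $S$ ordered by inclusion, with meet $I\cap J$ and joins $\bigvee^z_\lambda I_\lambda=\mathfrak{cl}_z(\sum_\lambda I_\lambda)$; it is a coherent frame. $\mathsf{CRig}_z$ is the category whose objects are commutative semirings and whose morphisms are semiring homomorphisms $\varphi:S\to T$ such that $\varphi^{-1}(J)$ is a $z$-ideal of $S$ for every $z$-ideal $J$ of $T$. A frame homomorphism preserves arbitrary joins and finite meets. A coherent frame is a frame whose top is compact, in which every element is a join of compact elements, and whose compact elements are closed under finite meets. $\mathsf{CohFrm}$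 is the category of coherent frames and frame homomorphisms preserving compact elements (coherent frame homomorphisms). *)

theory Defs
  imports "HOL-Algebra.Algebra"
begin

section \<open>Commutative semirings and their z-ideals\<close>

text \<open>The trivial semiring is allowed.\<close>

locale csemiring = semiring R + comm_monoid R for R (structure)

definition sr_ideal :: "('a, 'm) ring_scheme \<Rightarrow> 'a set \<Rightarrow> bool" where
  "sr_ideal S I \<longleftrightarrow> I \<subseteq> carrier S \<and> I \<noteq> {} \<and>
     (\<forall>a\<in>I. \<forall>b\<in>I. a \<oplus>\<^bsub>S\<^esub> b \<in> I) \<and> (\<forall>s\<in>carrier S. \<forall>a\<in>I. s \<otimes>\<^bsub>S\<^esub> a \<in> I)"

definition sr_maximal_ideal :: "('a, 'm) ring_scheme \<Rightarrow> 'a set \<Rightarrow> bool" where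
  "sr_maximal_ideal S M \<longleftrightarrow> sr_ideal S M \<and> M \<noteq> carrier S \<and>
     (\<forall>J. sr_ideal S J \<and> M \<subseteq> J \<and> J \<noteq> carrier S \<longrightarrow> J = M)"

definition maximal_ideals_over :: "('a, 'm) ring_scheme \<Rightarrow> 'a \<Rightarrow> 'a set set" where
  "maximal_ideals_over S a = {M. sr_maximal_ideal S M \<and> a \<in> M}"

definition z_ideal :: "('a, 'm) ring_scheme \<Rightarrow> 'a set \<Rightarrow> bool" where
  "z_ideal S I \<longleftrightarrow> sr_ideal S I \<and>
     (\<forall>a\<in>I. \<forall>b\<in>carrier S. maximal_ideals_over S a = maximal_ideals_over S b \<longrightarrow> b \<in> I)"

definition z_closure :: "('a, 'm) ring_scheme \<Rightarrow> 'a set \<Rightarrow> 'a set" where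
  "z_closure S I = \<Inter>{J. z_ideal S J \<and> I \<subseteq> J}"

definition z_principal :: "('a, 'm) ring_scheme \<Rightarrow> 'a \<Rightarrow> 'a set" where
  "z_principal S a = z_closure S (PIdl\<^bsub>S\<^esub> a)"

text \<open>The sum of a family of ideals: all sums of finitely many elements, one from each of finitely
  many members. Families are given as sets of ideals; since ideals are closed under addition,
  repeated members would not change the sum. The empty sum is the zero ideal.\<close>

definition sr_ideal_sum :: "('a, 'm) ring_scheme \<Rightarrow> 'a set set \<Rightarrow> 'a set" where
  "sr_ideal_sum S \<I> = {finsum S f F | f F. finite F \<and> F \<subseteq> \<I> \<and> (\<forall>I\<in>F. f I \<in> I)}"

definition z_join :: "('a, 'm) ring_scheme \<Rightarrow> 'a set set \<Rightarrow> 'a set" where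
  "z_join S \<I> = z_closure S (sr_ideal_sum S \<I>)"

definition ZId :: "('a, 'm) ring_scheme \<Rightarrow> 'a set gorder" where
  "ZId S = \<lparr>carrier = {I. z_ideal S I}, eq = (=), le = (\<subseteq>)\<rparr>"

text \<open>The library's \<open>ring_hom\<close> does not require preservation of zero, which is not automatic
  for semirings.\<close>

definition z_morphism :: "('a, 'm) ring_scheme \<Rightarrow> ('b, 'n) ring_scheme \<Rightarrow> ('a \<Rightarrow> 'b) \<Rightarrow> bool" where
  "z_morphism S T \<phi> \<longleftrightarrow> csemiring S \<and> csemiring T \<and>
     \<phi> \<in> ring_hom S T \<and> \<phi> \<zero>\<^bsub>S\<^esub> = \<zero>\<^bsub>T\<^esub> \<and>
     (\<forall>J. z_ideal T J \<longrightarrow> z_ideal S {x \<in> carrier S. \<phi> x \<in> J})"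

definition ZId_map ::
    "('a, 'm) ring_scheme \<Rightarrow> ('b, 'n) ring_scheme \<Rightarrow> ('a \<Rightarrow> 'b) \<Rightarrow> 'a set \<Rightarrow> 'b set" where
  "ZId_map S T \<phi> = (\<lambda>I\<in>carrier (ZId S). z_join T ((\<lambda>a. z_principal T (\<phi> a)) ` I))"

text \<open>The set-level descriptions of meets and joins agree with the order of \<^term>\<open>ZId S\<close>.\<close>

lemma sr_ideal_zero:
  assumes "csemiring S" "sr_ideal S I"
  shows "\<zero>\<^bsub>S\<^esub> \<in> I"
proof -
  interpret csemiring S by fact
  obtain a where "a \<in> I" "a \<in> carrier S"
    using assms(2) unfolding sr_ideal_def by blast
  then show ?thesis
    using assms(2) l_null[of a] unfolding sr_ideal_def by (metis zero_closed)
qed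

lemma z_ideal_Inter:
  assumes "csemiring S" "\<And>J. J \<in> \<J> \<Longrightarrow> z_ideal S J" "\<J> \<noteq> {}"
  shows "z_ideal S (\<Inter>\<J>)"
proof -
  have "\<zero>\<^bsub>S\<^esub> \<in> \<Inter>\<J>"
    using assms sr_ideal_zero unfolding z_ideal_def by blast
  then have "\<Inter>\<J> \<noteq> {}" by blast
  moreover have "\<Inter>\<J> \<subseteq> carrier S"
    using assms(2,3) unfolding z_ideal_def sr_ideal_def by blast
  ultimately show ?thesis
    using assms(2) unfolding z_ideal_def sr_ideal_def by (intro conjI) blast+
qed

lemma z_ideal_carrier:
  assumes "csemiring S"
  shows "z_ideal S (carrier S)"
proof -
  interpret csemiring S by fact
  show ?thesis unfolding z_ideal_def sr_ideal_def by auto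
qed

lemma z_meet_greatest:
  assumes "csemiring S" "z_ideal S I" "z_ideal S J"
  shows "greatest (ZId S) (I \<inter> J) (Lower (ZId S) {I, J})"
proof -
  have "z_ideal S (I \<inter> J)"
    using z_ideal_Inter[of S "{I, J}"] assms by auto
  then show ?thesis
    using assms unfolding greatest_def Lower_def ZId_def by auto
qed

lemma z_join_least:
  assumes S: "csemiring S" and zI: "\<And>I. I \<in> \<I> \<Longrightarrow> z_ideal S I"
  shows "least (ZId S) (z_join S \<I>) (Upper (ZId S) \<I>)"
proof -
  interpret csemiring S by fact
  have car: "I \<subseteq> carrier S" if "I \<in> \<I>" for I
    using zI[OF that] unfolding z_ideal_def sr_ideal_def by blast
  have sum_le: "sr_ideal_sum S \<I> \<subseteq> K" if K: "z_ideal S K" "\<And>I. I \<in> \<I> \<Longrightarrow> I \<subseteq> K" for K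
  proof -
    have idl: "sr_ideal S K" using K(1) unfolding z_ideal_def by blast
    have "finsum S f F \<in> K" if "finite F" "F \<subseteq> \<I>" "\<forall>I\<in>F. f I \<in> I" for f F
      using that
    proof (induction F rule: finite_induct)
      case empty
      then show ?case using sr_ideal_zero[OF S idl] by simp
    next
      case (insert I F)
      have "f \<in> F \<rightarrow> carrier S" "f I \<in> carrier S"
        using insert.prems car by blast+
      then have "finsum S f (insert I F) = f I \<oplus>\<^bsub>S\<^esub> finsum S f F"
        using insert.hyps by (simp add: finsum_insert)
      moreover have "f I \<in> K" "finsum S f F \<in> K"
        using insert K(2) by auto
      ultimately show ?case
        using idl unfolding sr_ideal_def by simp
    qed
    then show ?thesis unfolding sr_ideal_sum_def by auto
  qed
  have le_sum: "I \<subseteq> sr_ideal_sum S \<I>" if I: "I \<in> \<I>" for I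
  proof
    fix x assume x: "x \<in> I"
    then have "finsum S (\<lambda>_. x) {I} = x"
      using car[OF I] by (subst finsum_insert) auto
    then show "x \<in> sr_ideal_sum S \<I>"
      unfolding sr_ideal_sum_def using I x
      by (intro CollectI exI[of _ "\<lambda>_. x"] exI[of _ "{I}"]) auto
  qed
  have "{J. z_ideal S J \<and> sr_ideal_sum S \<I> \<subseteq> J} \<noteq> {}"
    using z_ideal_carrier[OF S] sum_le[of "carrier S"] car by blast
  then have z: "z_ideal S (z_join S \<I>)"
    unfolding z_join_def z_closure_def by (intro z_ideal_Inter[OF S]) auto
  moreover have "I \<subseteq> z_join S \<I>" if "I \<in> \<I>" for I
    using le_sum[OF that] unfolding z_join_def z_closure_def by blast
  moreover have "z_join S \<I> \<subseteq> K" if "z_ideal S K" "\<And>I. I \<in> \<I> \<Longrightarrow> I \<subseteq> K" for K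
    using sum_le[OF that] that(1) unfolding z_join_def z_closure_def by blast
  ultimately show ?thesis
    using zI unfolding least_def Upper_def ZId_def by auto
qed


section \<open>Coherent frames\<close>

locale frame = complete_lattice L for L (structure) +
  assumes meet_sup_distrib:
    "\<lbrakk>x \<in> carrier L; A \<subseteq> carrier L\<rbrakk> \<Longrightarrow> x \<sqinter> \<Squnion>A = \<Squnion>((\<lambda>y. x \<sqinter> y) ` A)"

definition compacts :: "('a, 'm) gorder_scheme \<Rightarrow> 'a set" where
  "compacts L = {k \<in> carrier L. \<forall>A. A \<subseteq> carrier L \<and> k \<sqsubseteq>\<^bsub>L\<^esub> \<Squnion>\<^bsub>L\<^esub>A \<longrightarrow>
     (\<exists>F. finite F \<and> F \<subseteq> A \<and> k \<sqsubseteq>\<^bsub>L\<^esub> \<Squnion>\<^bsub>L\<^esub>F)}"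

locale coherent_frame = frame +
  assumes top_compact: "\<top> \<in> compacts L"
    and sup_of_compacts: "x \<in> carrier L \<Longrightarrow> \<exists>K \<subseteq> compacts L. x = \<Squnion>K"
    and meet_compact: "\<lbrakk>k \<in> compacts L; l \<in> compacts L\<rbrakk> \<Longrightarrow> k \<sqinter> l \<in> compacts L"

definition frame_hom ::
    "('a, 'm) gorder_scheme \<Rightarrow> ('b, 'n) gorder_scheme \<Rightarrow> ('a \<Rightarrow> 'b) \<Rightarrow> bool" where
  "frame_hom L M h \<longleftrightarrow> frame L \<and> frame M \<and> h \<in> carrier L \<rightarrow> carrier M \<and>
     (\<forall>A. A \<subseteq> carrier L \<longrightarrow> h (\<Squnion>\<^bsub>L\<^esub>A) = \<Squnion>\<^bsub>M\<^esub>(h ` A)) \<and>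
     h \<top>\<^bsub>L\<^esub> = \<top>\<^bsub>M\<^esub> \<and>
     (\<forall>x\<in>carrier L. \<forall>y\<in>carrier L. h (x \<sqinter>\<^bsub>L\<^esub> y) = h x \<sqinter>\<^bsub>M\<^esub> h y)"

definition coherent_frame_hom ::
    "('a, 'm) gorder_scheme \<Rightarrow> ('b, 'n) gorder_scheme \<Rightarrow> ('a \<Rightarrow> 'b) \<Rightarrow> bool" where
  "coherent_frame_hom L M h \<longleftrightarrow> coherent_frame L \<and> coherent_frame M \<and> frame_hom L M h \<and>
     h ` compacts L \<subseteq> compacts M"


section \<open>Categories and functors\<close>

text \<open>Arrows are indexed by their domain and codomain, so hom-sets need not be disjoint;
  \<open>Cmp C A B D g f\<close> is the composite of \<open>f\<close> from \<open>A\<close> to \<open>B\<close> and \<open>g\<close> from \<open>B\<close> to \<open>D\<close>.\<close>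

record ('o, 'm) cat =
  Obj :: "'o set"
  Arr :: "'o \<Rightarrow> 'o \<Rightarrow> 'm set"
  Ide :: "'o \<Rightarrow> 'm"
  Cmp :: "'o \<Rightarrow> 'o \<Rightarrow> 'o \<Rightarrow> 'm \<Rightarrow> 'm \<Rightarrow> 'm"

locale cat_category =
  fixes C :: "('o, 'm) cat"
  assumes Ide_Arr: "A \<in> Obj C \<Longrightarrow> Ide C A \<in> Arr C A A"
    and Cmp_Arr: "\<lbrakk>A \<in> Obj C; B \<in> Obj C; D \<in> Obj C; f \<in> Arr C A B; g \<in> Arr C B D\<rbrakk>
      \<Longrightarrow> Cmp C A B D g f \<in> Arr C A D"
    and Cmp_Ide_right: "\<lbrakk>A \<in> Obj C; B \<in> Obj C; f \<in> Arr C A B\<rbrakk> \<Longrightarrow> Cmp C A A B f (Ide C A) = f"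
    and Cmp_Ide_left: "\<lbrakk>A \<in> Obj C; B \<in> Obj C; f \<in> Arr C A B\<rbrakk> \<Longrightarrow> Cmp C A B B (Ide C B) f = f"
    and Cmp_assoc: "\<lbrakk>A \<in> Obj C; B \<in> Obj C; D \<in> Obj C; E \<in> Obj C;
        f \<in> Arr C A B; g \<in> Arr C B D; h \<in> Arr C D E\<rbrakk>
      \<Longrightarrow> Cmp C A D E h (Cmp C A B D g f) = Cmp C A B E (Cmp C B D E h g) f"

locale cat_functor = C: cat_category C + D: cat_category D
  for C :: "('o, 'm) cat" and D :: "('p, 'n) cat" +
  fixes Fo :: "'o \<Rightarrow> 'p" and Fm :: "'o \<Rightarrow> 'o \<Rightarrow> 'm \<Rightarrow> 'n"
  assumes Fo_Obj: "A \<in> Obj C \<Longrightarrow> Fo A \<in> Obj D"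
    and Fm_Arr: "\<lbrakk>A \<in> Obj C; B \<in> Obj C; f \<in> Arr C A B\<rbrakk> \<Longrightarrow> Fm A B f \<in> Arr D (Fo A) (Fo B)"
    and Fm_Ide: "A \<in> Obj C \<Longrightarrow> Fm A A (Ide C A) = Ide D (Fo A)"
    and Fm_Cmp: "\<lbrakk>A \<in> Obj C; B \<in> Obj C; E \<in> Obj C; f \<in> Arr C A B; g \<in> Arr C B E\<rbrakk>
      \<Longrightarrow> Fm A E (Cmp C A B E g f) = Cmp D (Fo A) (Fo B) (Fo E) (Fm B E g) (Fm A B f)"

text \<open>Both categories are relative to a type \<open>'a\<close>, which plays the role of the universe: objects are
  the structures with carrier in \<open>'a\<close>. Arrows are represented by extensional functions, so that
  equality of arrows is equality on the carrier of the domain.\<close>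

definition CRigz :: "('a ring, 'a \<Rightarrow> 'a) cat" where
  "CRigz = \<lparr>Obj = {S. csemiring S},
     Arr = (\<lambda>S T. {\<phi> \<in> extensional (carrier S). z_morphism S T \<phi>}),
     Ide = (\<lambda>S. \<lambda>x\<in>carrier S. x),
     Cmp = (\<lambda>S T U \<psi> \<phi>. compose (carrier S) \<psi> \<phi>)\<rparr>"

definition CohFrm :: "('a gorder, 'a \<Rightarrow> 'a) cat" where
  "CohFrm = \<lparr>Obj = {L. coherent_frame L},
     Arr = (\<lambda>L M. {h \<in> extensional (carrier L). coherent_frame_hom L M h}),
     Ide = (\<lambda>L. \<lambda>x\<in>carrier L. x),
     Cmp = (\<lambda>L M N k h. compose (carrier L) k h)\<rparr>"

end

theory Submission
  imports Defs
begin

text \<open>For a z-ideal \<open>K\<close> and an element \<open>b\<close>, the residual \<open>{x. x b \<in> K}\<close> is again a z-ideal, because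
  maximal ideals are prime and hence \<open>\<M>(x b) = \<M>(x) \<union> \<M>(b)\<close>; moreover \<open>x \<in> K\<close> iff \<open>x x \<in> K\<close>.
  So a product relation \<open>B C \<subseteq> K\<close> between generating sets passes to their z-closures, and an
  intersection of z-closures is the z-closure of the products of generators. This gives the frame
  law, the closure of compact elements (the z-closures of finite sets) under meets, and
  preservation of meets by \<open>I \<mapsto> cl\<^sub>z (\<phi> I)\<close>.\<close>

section \<open>z-closures in a commutative semiring\<close>

lemma sr_ideal_subset: "sr_ideal S I \<Longrightarrow> I \<subseteq> carrier S"
  by (simp add: sr_ideal_def)

lemma sr_ideal_add:
  "sr_ideal S I \<Longrightarrow> a \<in> I \<Longrightarrow> b \<in> I \<Longrightarrow> a \<oplus>\<^bsub>S\<^esub> b \<in> I"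
  by (simp add: sr_ideal_def)

lemma sr_ideal_mult:
  "sr_ideal S I \<Longrightarrow> s \<in> carrier S \<Longrightarrow> a \<in> I \<Longrightarrow> s \<otimes>\<^bsub>S\<^esub> a \<in> I"
  by (simp add: sr_ideal_def)

lemma z_ideal_sr_ideal: "z_ideal S I \<Longrightarrow> sr_ideal S I"
  by (simp add: z_ideal_def)

lemma z_ideal_subset: "z_ideal S I \<Longrightarrow> I \<subseteq> carrier S"
  by (simp add: z_ideal_def sr_ideal_def)

lemma z_idealD:
  "z_ideal S I \<Longrightarrow> a \<in> I \<Longrightarrow> b \<in> carrier S \<Longrightarrow>
    maximal_ideals_over S a = maximal_ideals_over S b \<Longrightarrow> b \<in> I"
  unfolding z_ideal_def by blast

lemma z_closure_minimal: "z_ideal S K \<Longrightarrow> B \<subseteq> K \<Longrightarrow> z_closure S B \<subseteq> K"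
  unfolding z_closure_def by blast

lemma z_closure_extensive: "B \<subseteq> z_closure S B"
  unfolding z_closure_def by blast

lemma z_closure_mono: "B \<subseteq> C \<Longrightarrow> z_closure S B \<subseteq> z_closure S C"
  unfolding z_closure_def by blast

lemma z_closure_z_ideal_eq: "z_ideal S K \<Longrightarrow> z_closure S K = K"
  by (simp add: subset_antisym z_closure_extensive z_closure_minimal)

context csemiring
begin

section \<open>Prime maximal ideals, residuals and products of z-closures\<close>

lemma sr_ideal_mult_right:
  assumes "sr_ideal R I" "a \<in> I" "s \<in> carrier R"
  shows "a \<otimes> s \<in> I"
  using assms sr_ideal_mult[OF assms(1,3,2)] sr_ideal_subset[OF assms(1)] m_comm[of s a] by auto

text \<open>The usual ring argument survives without subtraction: the elements m + s b with m in
  \<open>M\<close> form an ideal, which is the whole semiring by maximality once b is outside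
  \<open>M\<close>. Multiplying 1 = m + s b by a puts a into \<open>M\<close>.\<close>

lemma maximal_ideal_prime:
  assumes M: "sr_maximal_ideal R M" and a: "a \<in> carrier R" and b: "b \<in> carrier R"
    and ab: "a \<otimes> b \<in> M"
  shows "a \<in> M \<or> b \<in> M"
proof (rule disjCI)
  assume nb: "b \<notin> M"
  have idl: "sr_ideal R M" using M by (simp add: sr_maximal_ideal_def)
  note sub = sr_ideal_subset[OF idl]
  have car: "m \<in> carrier R" if "m \<in> M" for m using sub that by blast
  have zero: "\<zero> \<in> M" using sr_ideal_zero[OF csemiring_axioms idl] .
  define J where "J = {m \<oplus> s \<otimes> b | m s. m \<in> M \<and> s \<in> carrier R}"
  have J: "sr_ideal R J"
    unfolding sr_ideal_def
  proof (intro conjI ballI)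
    show "J \<subseteq> carrier R" unfolding J_def using car b by auto
    show "J \<noteq> {}" unfolding J_def using zero by blast
  next
    fix x y assume "x \<in> J" "y \<in> J"
    then obtain m s n t where *: "x = m \<oplus> s \<otimes> b" "m \<in> M" "s \<in> carrier R"
        "y = n \<oplus> t \<otimes> b" "n \<in> M" "t \<in> carrier R"
      unfolding J_def by blast
    then have "x \<oplus> y = (m \<oplus> n) \<oplus> (s \<oplus> t) \<otimes> b"
      using car b by (simp add: l_distr a_ac)
    then show "x \<oplus> y \<in> J"
      unfolding J_def using * sr_ideal_add[OF idl] by blast
  next
    fix r x assume r: "r \<in> carrier R" and "x \<in> J"
    then obtain m s where *: "x = m \<oplus> s \<otimes> b" "m \<in> M" "s \<in> carrier R"
      unfolding J_def by blast
    then have "r \<otimes> x = r \<otimes> m \<oplus> (r \<otimes> s) \<otimes> b"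
      using car b r by (simp add: r_distr m_assoc)
    then show "r \<otimes> x \<in> J"
      unfolding J_def using * r sr_ideal_mult[OF idl] by blast
  qed
  have "M \<subseteq> J"
  proof
    fix m assume m: "m \<in> M"
    then have "m = m \<oplus> \<zero> \<otimes> b" using car b by simp
    then show "m \<in> J" unfolding J_def using m by blast
  qed
  moreover have "b \<in> J"
  proof -
    have "b = \<zero> \<oplus> \<one> \<otimes> b" using b by simp
    then show ?thesis unfolding J_def using zero by blast
  qed
  ultimately have "J = carrier R"
    using M J nb unfolding sr_maximal_ideal_def by blast
  then obtain m s where *: "\<one> = m \<oplus> s \<otimes> b" "m \<in> M" "s \<in> carrier R"
    unfolding J_def using one_closed by blast
  \<comment> \<open>Both summands lie in \<open>M\<close>: the first because m does, the second
    because a b does.\<close>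
  then have "a = a \<otimes> m \<oplus> s \<otimes> (a \<otimes> b)"
    using a b car r_distr[of m "s \<otimes> b" a] by (simp add: m_lcomm) (metis r_one)
  then show "a \<in> M"
    using sr_ideal_add[OF idl] sr_ideal_mult[OF idl] a ab * by metis
qed

lemma maximal_ideals_over_mult:
  assumes a: "a \<in> carrier R" and b: "b \<in> carrier R"
  shows "maximal_ideals_over R (a \<otimes> b) = maximal_ideals_over R a \<union> maximal_ideals_over R b"
proof -
  have "a \<otimes> b \<in> M \<longleftrightarrow> a \<in> M \<or> b \<in> M" if M: "sr_maximal_ideal R M" for M
  proof -
    have "sr_ideal R M" using M by (simp add: sr_maximal_ideal_def)
    then show ?thesis
      using maximal_ideal_prime[OF M a b] sr_ideal_mult[of R M] a b m_comm by metis
  qed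
  then show ?thesis unfolding maximal_ideals_over_def by blast
qed

text \<open>The elements x x and x lie in the same maximal ideals, so a z-ideal cannot separate
  them. This turns statements about products into statements about intersections.\<close>

lemma z_ideal_square:
  assumes "z_ideal R K" "x \<in> carrier R" "x \<otimes> x \<in> K"
  shows "x \<in> K"
  using z_idealD[OF assms(1,3,2)] maximal_ideals_over_mult[OF assms(2,2)] by simp

text \<open>The z-condition is inherited because M(x) = M(y) forces M(x b) = M(x) \<union> M(b) =
  M(y b), so that \<open>K\<close> cannot separate x b from y b.\<close>

lemma z_ideal_residual:
  assumes K: "z_ideal R K" and b: "b \<in> carrier R"
  shows "z_ideal R {x \<in> carrier R. x \<otimes> b \<in> K}"
  unfolding z_ideal_def sr_ideal_def
proof (intro conjI ballI impI)
  note idl = z_ideal_sr_ideal[OF K]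
  have "\<zero> \<in> K" using sr_ideal_zero[OF csemiring_axioms idl] .
  then have "\<zero> \<in> {x \<in> carrier R. x \<otimes> b \<in> K}" using b by simp
  then show "{x \<in> carrier R. x \<otimes> b \<in> K} \<noteq> {}" by blast
  show "x \<oplus> y \<in> {x \<in> carrier R. x \<otimes> b \<in> K}"
    if "x \<in> {x \<in> carrier R. x \<otimes> b \<in> K}" "y \<in> {x \<in> carrier R. x \<otimes> b \<in> K}" for x y
    using that b sr_ideal_add[OF idl] by (simp add: l_distr)
  show "s \<otimes> x \<in> {x \<in> carrier R. x \<otimes> b \<in> K}"
    if "s \<in> carrier R" "x \<in> {x \<in> carrier R. x \<otimes> b \<in> K}" for s x
    using that b sr_ideal_mult[OF idl] by (simp add: m_assoc)
  show "y \<in> {x \<in> carrier R. x \<otimes> b \<in> K}"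
    if "x \<in> {x \<in> carrier R. x \<otimes> b \<in> K}" "y \<in> carrier R"
      "maximal_ideals_over R x = maximal_ideals_over R y" for x y
    using that b z_idealD[OF K, of "x \<otimes> b" "y \<otimes> b"] by (simp add: maximal_ideals_over_mult)
qed auto

text \<open>Elements of a z-closure have no explicit description here, so one factor is extended at
  a time: the residual of \<open>K\<close> by a fixed v in \<open>C\<close> is a z-ideal containing
  \<open>B\<close>, hence its closure; then the residual by a fixed x in that closure contains
  \<open>C\<close>, hence its closure.\<close>

lemma z_closure_mult:
  assumes K: "z_ideal R K" and B: "B \<subseteq> carrier R" and C: "C \<subseteq> carrier R"
    and BC: "\<And>x y. x \<in> B \<Longrightarrow> y \<in> C \<Longrightarrow> x \<otimes> y \<in> K"
    and x: "x \<in> z_closure R B" and y: "y \<in> z_closure R C"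
  shows "x \<otimes> y \<in> K"
proof -
  have left: "u \<otimes> v \<in> K" if "u \<in> z_closure R B" "v \<in> C" for u v
    using z_closure_minimal[OF z_ideal_residual[OF K, of v], of B] that B C BC by blast
  have "x \<in> carrier R"
    using x z_closure_minimal[OF z_ideal_carrier[OF csemiring_axioms] B] by blast
  moreover have "C \<subseteq> {v \<in> carrier R. v \<otimes> x \<in> K}"
    using left[OF x] C m_comm \<open>x \<in> carrier R\<close> by fastforce
  ultimately have "y \<otimes> x \<in> K" "y \<in> carrier R"
    using z_closure_minimal[OF z_ideal_residual[OF K, of x], of C] y by blast+
  then show ?thesis using m_comm \<open>x \<in> carrier R\<close> by simp
qed

text \<open>An element x of both closures can serve as both factors in
  \<open>z_closure_mult\<close>, so x x is in \<open>K\<close>, and then so is x.\<close>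

lemma z_closure_Int_subset:
  assumes K: "z_ideal R K" and B: "B \<subseteq> carrier R" and C: "C \<subseteq> carrier R"
    and BC: "\<And>x y. x \<in> B \<Longrightarrow> y \<in> C \<Longrightarrow> x \<otimes> y \<in> K"
  shows "z_closure R B \<inter> z_closure R C \<subseteq> K"
proof
  fix x assume "x \<in> z_closure R B \<inter> z_closure R C"
  moreover from this have "x \<in> carrier R"
    using z_closure_minimal[OF z_ideal_carrier[OF csemiring_axioms] B] by blast
  ultimately show "x \<in> K"
    using z_ideal_square[OF K] z_closure_mult[OF K B C BC] by blast
qed

section \<open>Generating sets of z-ideals and finitary character of the closure\<close>

lemma z_ideal_z_closure:
  assumes "B \<subseteq> carrier R"
  shows "z_ideal R (z_closure R B)"
  \<comment> \<open>The carrier is itself a z-ideal containing \<open>B\<close>, so the family being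
    intersected is non-empty; an empty family would give the whole type.\<close>
  unfolding z_closure_def
  using assms z_ideal_carrier[OF csemiring_axioms] by (intro z_ideal_Inter[OF csemiring_axioms]) auto

lemma z_closure_subset: "B \<subseteq> carrier R \<Longrightarrow> z_closure R B \<subseteq> carrier R"
  by (simp add: z_closure_minimal z_ideal_carrier csemiring_axioms)

text \<open>A z-ideal containing \<open>B i\<close> already contains its closure. Joins of generated
  z-ideals can thus be computed on generators alone.\<close>

lemma z_closure_UN_z_closure:
  assumes B: "\<And>i. i \<in> A \<Longrightarrow> B i \<subseteq> carrier R"
  shows "z_closure R (\<Union>i\<in>A. z_closure R (B i)) = z_closure R (\<Union>i\<in>A. B i)" (is "?l = ?r")
proof
  have "z_closure R (B i) \<subseteq> ?r" if "i \<in> A" for i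
    using that by (intro z_closure_mono) blast
  then show "?l \<subseteq> ?r"
    using B by (intro z_closure_minimal z_ideal_z_closure) blast+
  show "?r \<subseteq> ?l"
    using z_closure_extensive[where S = R] by (intro z_closure_mono) blast
qed

text \<open>The closures of finite subfamilies form a directed system, so their union
  \<open>D\<close> is a z-ideal: only addition involves two elements, and these are caught together
  by the union of their two subfamilies. Since \<open>D\<close> contains every member of the family,
  it contains the closure of the whole union.\<close>

lemma z_closure_Union_finite:
  assumes \<I>: "\<And>I. I \<in> \<I> \<Longrightarrow> I \<subseteq> carrier R" and x: "x \<in> z_closure R (\<Union>\<I>)"
  shows "\<exists>\<F>. finite \<F> \<and> \<F> \<subseteq> \<I> \<and> x \<in> z_closure R (\<Union>\<F>)"
proof -
  define D where "D = {x. \<exists>\<F>. finite \<F> \<and> \<F> \<subseteq> \<I> \<and> x \<in> z_closure R (\<Union>\<F>)}"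
  have z: "z_ideal R (z_closure R (\<Union>\<F>))" if "\<F> \<subseteq> \<I>" for \<F>
    using that \<I> by (intro z_ideal_z_closure) blast
  have sub: "D \<subseteq> carrier R"
    unfolding D_def using z_ideal_subset[OF z] by blast
  have "z_ideal R D"
    unfolding z_ideal_def sr_ideal_def
  proof (intro conjI ballI impI)
    show "D \<subseteq> carrier R" by (rule sub)
    \<comment> \<open>The empty subfamily is used here, so that an empty family is covered as
      well.\<close>
    have "\<zero> \<in> z_closure R (\<Union>{})"
      using sr_ideal_zero[OF csemiring_axioms z_ideal_sr_ideal[OF z]] by blast
    then show "D \<noteq> {}" unfolding D_def by blast
  next
    fix a b assume "a \<in> D" "b \<in> D"
    then obtain \<F> \<G> where *: "finite \<F>" "\<F> \<subseteq> \<I>" "a \<in> z_closure R (\<Union>\<F>)"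
        "finite \<G>" "\<G> \<subseteq> \<I>" "b \<in> z_closure R (\<Union>\<G>)"
      unfolding D_def by blast
    have "a \<in> z_closure R (\<Union>(\<F> \<union> \<G>))" "b \<in> z_closure R (\<Union>(\<F> \<union> \<G>))"
      using * z_closure_mono[of "\<Union>\<F>" "\<Union>(\<F> \<union> \<G>)" R] z_closure_mono[of "\<Union>\<G>" "\<Union>(\<F> \<union> \<G>)" R] by auto
    then have "a \<oplus> b \<in> z_closure R (\<Union>(\<F> \<union> \<G>))"
      using * by (intro sr_ideal_add z_ideal_sr_ideal z) auto
    then show "a \<oplus> b \<in> D"
      unfolding D_def using * by (intro CollectI exI[of _ "\<F> \<union> \<G>"]) auto
  next
    fix s a assume "s \<in> carrier R" "a \<in> D"
    then show "s \<otimes> a \<in> D"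
      unfolding D_def using sr_ideal_mult[OF z_ideal_sr_ideal[OF z]] by blast
  next
    fix a b assume "a \<in> D" "b \<in> carrier R" "maximal_ideals_over R a = maximal_ideals_over R b"
    then show "b \<in> D"
      unfolding D_def using z_idealD[OF z] by blast
  qed
  moreover have "\<Union>\<I> \<subseteq> D"
  proof
    fix y assume "y \<in> \<Union>\<I>"
    then obtain I where "I \<in> \<I>" "y \<in> I" by blast
    then show "y \<in> D"
      unfolding D_def using z_closure_extensive[of "\<Union>{I}" R]
      by (intro CollectI exI[of _ "{I}"]) auto
  qed
  ultimately have "x \<in> D"
    using z_closure_minimal x by blast
  then show ?thesis unfolding D_def by blast
qed

text \<open>The multiples of a include 1 a = a and lie in every ideal containing a, so the principal
  ideal and the singleton generate the same z-ideal.\<close>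

lemma z_principal_eq_z_closure:
  assumes a: "a \<in> carrier R"
  shows "z_principal R a = z_closure R {a}"
proof -
  have "PIdl a \<subseteq> carrier R" "a \<in> PIdl a"
    unfolding cgenideal_def using a l_one[of a] by (auto intro!: exI[of _ \<one>])
  moreover have "PIdl a \<subseteq> z_closure R {a}"
    unfolding cgenideal_def
    using sr_ideal_mult[OF z_ideal_sr_ideal[OF z_ideal_z_closure]] a
      z_closure_extensive[of "{a}" R] by blast
  ultimately show ?thesis
    unfolding z_principal_def
    using a by (intro subset_antisym z_closure_minimal z_ideal_z_closure)
      (use z_closure_extensive[of "PIdl a" R] in blast)+
qed


section \<open>The coherent frame of z-ideals\<close>

lemma partial_order_ZId: "partial_order (ZId R)"
  by unfold_locales (auto simp: ZId_def)

text \<open>Upper bounds of the family are exactly the z-ideals containing its union. This describes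
  joins without the finite sums in \<open>z_join\<close>.\<close>

lemma least_ZId_z_closure:
  assumes "\<I> \<subseteq> carrier (ZId R)"
  shows "least (ZId R) (z_closure R (\<Union>\<I>)) (Upper (ZId R) \<I>)"
proof -
  have "\<Union>\<I> \<subseteq> carrier R"
    using assms z_ideal_subset unfolding ZId_def by fastforce
  then have z: "z_ideal R (z_closure R (\<Union>\<I>))" by (rule z_ideal_z_closure)
  show ?thesis
  proof (rule least_UpperI)
    show "I \<sqsubseteq>\<^bsub>ZId R\<^esub> z_closure R (\<Union>\<I>)" if "I \<in> \<I>" for I
      using that z_closure_extensive[of "\<Union>\<I>" R] by (auto simp: ZId_def)
    show "z_closure R (\<Union>\<I>) \<sqsubseteq>\<^bsub>ZId R\<^esub> K" if K: "K \<in> Upper (ZId R) \<I>" for K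
    proof -
      have "z_ideal R K" "\<Union>\<I> \<subseteq> K"
        using K assms unfolding Upper_def ZId_def by auto
      then show ?thesis by (simp add: ZId_def z_closure_minimal)
    qed
  qed (use assms z in \<open>auto simp: ZId_def\<close>)
qed

lemma complete_lattice_ZId: "complete_lattice (ZId R)"
proof -
  interpret L: partial_order "ZId R" by (rule partial_order_ZId)
  show ?thesis
  proof (rule L.complete_lattice_criterion1)
    show "\<exists>g. greatest (ZId R) g (carrier (ZId R))"
      using z_ideal_carrier[OF csemiring_axioms] z_ideal_subset[of R]
      unfolding greatest_def ZId_def by auto
    \<comment> \<open>Infima of non-empty families are plain intersections; the empty family is
      accounted for by the greatest element above.\<close>
    show "\<exists>i. greatest (ZId R) i (Lower (ZId R) A)"
      if "A \<subseteq> carrier (ZId R)" "A \<noteq> {}" for A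
    proof
      have "z_ideal R (\<Inter>A)"
        using that by (intro z_ideal_Inter[OF csemiring_axioms]) (auto simp: ZId_def)
      then show "greatest (ZId R) (\<Inter>A) (Lower (ZId R) A)"
        using that unfolding greatest_def Lower_def ZId_def by auto
    qed
  qed
qed

lemma sup_ZId:
  assumes "\<I> \<subseteq> carrier (ZId R)"
  shows "\<Squnion>\<^bsub>ZId R\<^esub>\<I> = z_closure R (\<Union>\<I>)"
proof -
  interpret L: complete_lattice "ZId R" by (rule complete_lattice_ZId)
  show ?thesis
    using L.least_unique[OF L.sup_lub[OF assms] least_ZId_z_closure[OF assms]] .
qed

text \<open>Both sides are least upper bounds of the same family in a partial order, so the finite
  sums never have to be manipulated.\<close>

lemma z_join_eq_z_closure:
  assumes "\<And>I. I \<in> \<I> \<Longrightarrow> z_ideal R I"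
  shows "z_join R \<I> = z_closure R (\<Union>\<I>)"
proof -
  have "\<I> \<subseteq> carrier (ZId R)" using assms by (auto simp: ZId_def)
  then show ?thesis
    using partial_order.least_unique[OF partial_order_ZId z_join_least[OF csemiring_axioms assms]
        least_ZId_z_closure] by blast
qed

lemma meet_ZId:
  assumes "I \<in> carrier (ZId R)" "J \<in> carrier (ZId R)"
  shows "I \<sqinter>\<^bsub>ZId R\<^esub> J = I \<inter> J"
proof -
  interpret L: complete_lattice "ZId R" by (rule complete_lattice_ZId)
  have "greatest (ZId R) (I \<sqinter>\<^bsub>ZId R\<^esub> J) (Lower (ZId R) {I, J})"
    unfolding meet_def using assms by (intro L.inf_glb) auto
  moreover have "greatest (ZId R) (I \<inter> J) (Lower (ZId R) {I, J})"
    using assms by (intro z_meet_greatest csemiring_axioms) (auto simp: ZId_def)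
  ultimately show ?thesis by (rule L.greatest_unique)
qed

lemma top_ZId: "\<top>\<^bsub>ZId R\<^esub> = carrier R"
proof -
  interpret L: complete_lattice "ZId R" by (rule complete_lattice_ZId)
  have "carrier R .=\<^bsub>ZId R\<^esub> \<top>\<^bsub>ZId R\<^esub>"
    using z_ideal_carrier[OF csemiring_axioms] z_ideal_subset[of R]
    by (intro L.top_weak_eq) (auto simp: ZId_def)
  then show ?thesis by (simp add: L.eq_is_equal)
qed

text \<open>Only one inclusion of the distributive law is substantial. Products of elements of
  \<open>I\<close> with elements of a member J lie in both ideals, so
  \<open>z_closure_Int_subset\<close> applies with generating sets \<open>I\<close>, which is its
  own closure, and the union of the family.\<close>

lemma frame_ZId: "frame (ZId R)"
proof -
  interpret L: complete_lattice "ZId R" by (rule complete_lattice_ZId)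
  show ?thesis
  proof
    fix I \<A> assume I: "I \<in> carrier (ZId R)" and \<A>: "\<A> \<subseteq> carrier (ZId R)"
    have zI: "z_ideal R I" using I by (simp add: ZId_def)
    have z\<A>: "z_ideal R J" if "J \<in> \<A>" for J using \<A> that by (auto simp: ZId_def)
    have meets: "(\<lambda>J. I \<sqinter>\<^bsub>ZId R\<^esub> J) ` \<A> = (\<lambda>J. I \<inter> J) ` \<A>"
      using meet_ZId[OF I] \<A> by (intro image_cong) auto
    have "(\<lambda>J. I \<inter> J) ` \<A> \<subseteq> carrier (ZId R)"
      unfolding meets[symmetric] using I \<A> by auto
    then have rhs: "\<Squnion>\<^bsub>ZId R\<^esub>((\<lambda>J. I \<sqinter>\<^bsub>ZId R\<^esub> J) ` \<A>) = z_closure R (\<Union>J\<in>\<A>. I \<inter> J)"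
      unfolding meets by (rule sup_ZId)
    have lhs: "I \<sqinter>\<^bsub>ZId R\<^esub> \<Squnion>\<^bsub>ZId R\<^esub>\<A> = I \<inter> z_closure R (\<Union>\<A>)"
      using I \<A> by (metis L.sup_closed meet_ZId sup_ZId)
    have sub: "I \<subseteq> carrier R" "\<Union>\<A> \<subseteq> carrier R"
      using z_ideal_subset zI z\<A> by blast+
    let ?K = "z_closure R (\<Union>J\<in>\<A>. I \<inter> J)"
    have K: "z_ideal R ?K" using sub by (intro z_ideal_z_closure) blast
    have "x \<otimes> y \<in> ?K" if xy: "x \<in> I" "y \<in> \<Union>\<A>" for x y
    proof -
      obtain J where J: "J \<in> \<A>" "y \<in> J" using xy(2) by blast
      have "x \<otimes> y \<in> J"
        using J sr_ideal_mult[OF z_ideal_sr_ideal[OF z\<A>]] xy(1) sub by blast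
      moreover have "x \<otimes> y \<in> I"
        using sr_ideal_mult_right[OF z_ideal_sr_ideal[OF zI]] xy sub by blast
      ultimately show ?thesis using J z_closure_extensive[of "\<Union>J\<in>\<A>. I \<inter> J" R] by blast
    qed
    then have "z_closure R I \<inter> z_closure R (\<Union>\<A>) \<subseteq> ?K"
      by (rule z_closure_Int_subset[OF K sub])
    moreover have "?K \<subseteq> I" using zI by (intro z_closure_minimal) auto
    moreover have "?K \<subseteq> z_closure R (\<Union>\<A>)" by (intro z_closure_mono) blast
    ultimately have "I \<inter> z_closure R (\<Union>\<A>) = ?K"
      by (auto simp: z_closure_z_ideal_eq[OF zI])
    then show "I \<sqinter>\<^bsub>ZId R\<^esub> \<Squnion>\<^bsub>ZId R\<^esub>\<A> = \<Squnion>\<^bsub>ZId R\<^esub>((\<lambda>J. I \<sqinter>\<^bsub>ZId R\<^esub> J) ` \<A>)"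
      using lhs rhs by simp
  qed
qed

section \<open>Compact elements and coherence\<close>

lemma z_closure_finite_compact:
  assumes F: "finite F" "F \<subseteq> carrier R"
  shows "z_closure R F \<in> compacts (ZId R)"
  unfolding compacts_def
proof (intro CollectI conjI allI impI)
  show "z_closure R F \<in> carrier (ZId R)"
    using z_ideal_z_closure[OF F(2)] by (simp add: ZId_def)
next
  fix \<A> assume "\<A> \<subseteq> carrier (ZId R) \<and> z_closure R F \<sqsubseteq>\<^bsub>ZId R\<^esub> \<Squnion>\<^bsub>ZId R\<^esub>\<A>"
  then have \<A>: "\<A> \<subseteq> carrier (ZId R)" and le: "z_closure R F \<subseteq> z_closure R (\<Union>\<A>)"
    using sup_ZId by (auto simp: ZId_def)
  have car: "J \<subseteq> carrier R" if "J \<in> \<A>" for J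
    using \<A> that z_ideal_subset by (auto simp: ZId_def)
  \<comment> \<open>Each generator needs only finitely many members of the cover; as there are
    finitely many generators, the union of the chosen subfamilies is still finite.\<close>
  have "\<exists>\<F>. finite \<F> \<and> \<F> \<subseteq> \<A> \<and> x \<in> z_closure R (\<Union>\<F>)" if "x \<in> F" for x
    using z_closure_Union_finite[of \<A> x] car le that z_closure_extensive[of F R] by blast
  then obtain G where G: "\<And>x. x \<in> F \<Longrightarrow> finite (G x) \<and> G x \<subseteq> \<A> \<and> x \<in> z_closure R (\<Union>(G x))"
    by metis
  let ?G = "\<Union>x\<in>F. G x"
  have fin: "finite ?G" "?G \<subseteq> \<A>" using F G by auto
  have "x \<in> z_closure R (\<Union>?G)" if "x \<in> F" for x
    using G[OF that] that z_closure_mono[of "\<Union>(G x)" "\<Union>?G" R] by blast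
  then have "z_closure R F \<subseteq> z_closure R (\<Union>?G)"
    using fin car by (intro z_closure_minimal z_ideal_z_closure) blast+
  then have "z_closure R F \<sqsubseteq>\<^bsub>ZId R\<^esub> \<Squnion>\<^bsub>ZId R\<^esub>?G"
    using sup_ZId[of ?G] fin \<A> by (auto simp: ZId_def)
  with fin show "\<exists>\<F>. finite \<F> \<and> \<F> \<subseteq> \<A> \<and> z_closure R F \<sqsubseteq>\<^bsub>ZId R\<^esub> \<Squnion>\<^bsub>ZId R\<^esub>\<F>"
    by blast
qed

text \<open>Singleton closures are compact, so this gives generation by compacts. It is also the
  cover from which finite generating sets of compact z-ideals are extracted.\<close>

lemma ZId_eq_sup_singletons:
  assumes I: "I \<in> carrier (ZId R)"
  shows "\<Squnion>\<^bsub>ZId R\<^esub>((\<lambda>a. z_closure R {a}) ` I) = I"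
proof -
  have zI: "z_ideal R I" using I by (simp add: ZId_def)
  have sub: "I \<subseteq> carrier R" using z_ideal_subset[OF zI] .
  have "(\<lambda>a. z_closure R {a}) ` I \<subseteq> carrier (ZId R)"
    using sub z_ideal_z_closure by (auto simp: ZId_def)
  then show ?thesis
    using sup_ZId z_closure_UN_z_closure[of I "\<lambda>a. {a}"] sub z_closure_z_ideal_eq[OF zI] by auto
qed

text \<open>Converse of \<open>z_closure_finite_compact\<close>: compactness applied to the cover of
  \<open>k\<close> by closures of its own elements leaves finitely many elements, and these generate
  \<open>k\<close>.\<close>

lemma compact_obtain_finite:
  assumes k: "k \<in> compacts (ZId R)"
  obtains F where "finite F" "F \<subseteq> carrier R" "k = z_closure R F"
proof -
  have kc: "k \<in> carrier (ZId R)" using k by (simp add: compacts_def)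
  then have zk: "z_ideal R k" by (simp add: ZId_def)
  have sub: "k \<subseteq> carrier R" using z_ideal_subset[OF zk] .
  have gens: "(\<lambda>a. z_closure R {a}) ` k \<subseteq> carrier (ZId R)"
    using sub z_ideal_z_closure by (auto simp: ZId_def)
  have "k \<sqsubseteq>\<^bsub>ZId R\<^esub> \<Squnion>\<^bsub>ZId R\<^esub>((\<lambda>a. z_closure R {a}) ` k)"
    using ZId_eq_sup_singletons[OF kc] by (simp add: ZId_def)
  then obtain \<F> where "finite \<F>" "\<F> \<subseteq> (\<lambda>a. z_closure R {a}) ` k" "k \<sqsubseteq>\<^bsub>ZId R\<^esub> \<Squnion>\<^bsub>ZId R\<^esub>\<F>"
    using k gens unfolding compacts_def by blast
  moreover from this obtain F where F: "F \<subseteq> k" "finite F" "\<F> = (\<lambda>a. z_closure R {a}) ` F"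
    using finite_subset_image by meson
  ultimately have "k \<subseteq> z_closure R (\<Union>a\<in>F. z_closure R {a})"
    using sup_ZId[of \<F>] gens by (auto simp: ZId_def)
  then have "k \<subseteq> z_closure R F"
    using z_closure_UN_z_closure[of F "\<lambda>a. {a}"] F(1) sub by auto
  then have "k = z_closure R F"
    using z_closure_minimal[OF zk F(1)] by blast
  with F sub show thesis using that by blast
qed

text \<open>The pairwise products of two finite generating sets form a finite set generating the
  intersection: absorption puts them into both z-ideals, and \<open>z_closure_Int_subset\<close>
  gives the other inclusion.\<close>

lemma compact_Int:
  assumes "k \<in> compacts (ZId R)" "l \<in> compacts (ZId R)"
  shows "k \<inter> l \<in> compacts (ZId R)"
proof -
  obtain F where F: "finite F" "F \<subseteq> carrier R" "k = z_closure R F"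
    using compact_obtain_finite[OF assms(1)] .
  obtain G where G: "finite G" "G \<subseteq> carrier R" "l = z_closure R G"
    using compact_obtain_finite[OF assms(2)] .
  let ?P = "(\<lambda>(x, y). x \<otimes> y) ` (F \<times> G)"
  have P: "finite ?P" "?P \<subseteq> carrier R" using F G by auto
  have "z_closure R F \<inter> z_closure R G \<subseteq> z_closure R ?P"
    using z_closure_extensive[of ?P R]
    by (intro z_closure_Int_subset z_ideal_z_closure P F G) blast
  moreover have "z_closure R ?P \<subseteq> z_closure R F"
  proof (rule z_closure_minimal)
    show "z_ideal R (z_closure R F)" using z_ideal_z_closure[OF F(2)] .
    show "?P \<subseteq> z_closure R F"
      using sr_ideal_mult_right[OF z_ideal_sr_ideal[OF z_ideal_z_closure[OF F(2)]]]
        z_closure_extensive[of F R] G(2) by auto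
  qed
  moreover have "z_closure R ?P \<subseteq> z_closure R G"
  proof (rule z_closure_minimal)
    show "z_ideal R (z_closure R G)" using z_ideal_z_closure[OF G(2)] .
    show "?P \<subseteq> z_closure R G"
      using sr_ideal_mult[OF z_ideal_sr_ideal[OF z_ideal_z_closure[OF G(2)]]]
        z_closure_extensive[of G R] F(2) by auto
  qed
  ultimately have "k \<inter> l = z_closure R ?P" using F G by blast
  then show ?thesis using z_closure_finite_compact[OF P] by simp
qed

lemma coherent_frame_ZId: "coherent_frame (ZId R)"
proof -
  interpret L: frame "ZId R" by (rule frame_ZId)
  show ?thesis
  proof
    \<comment> \<open>The top is generated by the single element 1, hence compact.\<close>
    have "carrier R \<subseteq> z_closure R {\<one>}"
    proof
      fix x assume x: "x \<in> carrier R"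
      have "sr_ideal R (z_closure R {\<one>})"
        by (intro z_ideal_sr_ideal z_ideal_z_closure) simp
      then have "x \<otimes> \<one> \<in> z_closure R {\<one>}"
        using z_closure_extensive[of "{\<one>}" R] x by (intro sr_ideal_mult) auto
      with x show "x \<in> z_closure R {\<one>}" by simp
    qed
    then have "z_closure R {\<one>} = carrier R" using z_closure_subset[of "{\<one>}"] by blast
    then show "\<top>\<^bsub>ZId R\<^esub> \<in> compacts (ZId R)"
      using z_closure_finite_compact[of "{\<one>}"] by (simp add: top_ZId)
  next
    fix I assume I: "I \<in> carrier (ZId R)"
    then have "I \<subseteq> carrier R" using z_ideal_subset by (simp add: ZId_def)
    then have "(\<lambda>a. z_closure R {a}) ` I \<subseteq> compacts (ZId R)"
      by (auto intro!: z_closure_finite_compact)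
    then show "\<exists>K\<subseteq>compacts (ZId R). I = \<Squnion>\<^bsub>ZId R\<^esub>K"
      using ZId_eq_sup_singletons[OF I] by metis
  next
    fix k l assume kl: "k \<in> compacts (ZId R)" "l \<in> compacts (ZId R)"
    then show "k \<sqinter>\<^bsub>ZId R\<^esub> l \<in> compacts (ZId R)"
      using compact_Int[OF kl] meet_ZId[of k l] by (simp add: compacts_def)
  qed
qed

end


section \<open>The functor on morphisms\<close>

lemma z_morphism_image_subset:
  "z_morphism S T \<phi> \<Longrightarrow> B \<subseteq> carrier S \<Longrightarrow> \<phi> ` B \<subseteq> carrier T"
  by (auto simp: z_morphism_def ring_hom_def)

lemma z_morphism_preimage:
  "z_morphism S T \<phi> \<Longrightarrow> z_ideal T J \<Longrightarrow> z_ideal S {x \<in> carrier S. \<phi> x \<in> J}"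
  unfolding z_morphism_def by blast

text \<open>The preimage of \<open>?r\<close> is a z-ideal by the defining condition on morphisms,
  and it contains \<open>B\<close>, hence also the closure of \<open>B\<close>. So the induced map
  can be evaluated on any generating set of a z-ideal.\<close>

lemma z_closure_image_z_closure:
  assumes \<phi>: "z_morphism S T \<phi>" and B: "B \<subseteq> carrier S"
  shows "z_closure T (\<phi> ` z_closure S B) = z_closure T (\<phi> ` B)" (is "?l = ?r")
proof
  interpret T: csemiring T using \<phi> by (simp add: z_morphism_def)
  have z: "z_ideal T ?r"
    by (intro T.z_ideal_z_closure z_morphism_image_subset[OF \<phi> B])
  have "z_closure S B \<subseteq> {x \<in> carrier S. \<phi> x \<in> ?r}"
    using B z_closure_extensive[of "\<phi> ` B" T]
    by (intro z_closure_minimal z_morphism_preimage[OF \<phi> z]) blast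
  then show "?l \<subseteq> ?r"
    by (intro z_closure_minimal z) blast
  show "?r \<subseteq> ?l"
    by (intro z_closure_mono image_mono z_closure_extensive)
qed

text \<open>The join of principal z-ideals collapses to one closure, because the closures of the
  singletons may be dropped inside the outer one. Later computations start from this form.\<close>

lemma ZId_map_eq:
  assumes \<phi>: "z_morphism S T \<phi>" and I: "I \<in> carrier (ZId S)"
  shows "ZId_map S T \<phi> I = z_closure T (\<phi> ` I)"
proof -
  interpret T: csemiring T using \<phi> by (simp add: z_morphism_def)
  have \<phi>I: "\<phi> ` I \<subseteq> carrier T"
    using I z_ideal_subset by (intro z_morphism_image_subset[OF \<phi>]) (auto simp: ZId_def)
  then have pr: "(\<lambda>a. z_principal T (\<phi> a)) ` I = (\<lambda>b. z_closure T {b}) ` \<phi> ` I"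
    unfolding image_image by (intro image_cong) (auto simp: T.z_principal_eq_z_closure)
  have "ZId_map S T \<phi> I = z_join T ((\<lambda>b. z_closure T {b}) ` \<phi> ` I)"
    using I by (simp add: ZId_map_def pr)
  also have "\<dots> = z_closure T (\<Union>b\<in>\<phi> ` I. z_closure T {b})"
    using \<phi>I by (intro T.z_join_eq_z_closure) (auto intro!: T.z_ideal_z_closure)
  also have "\<dots> = z_closure T (\<phi> ` I)"
    using \<phi>I by (subst T.z_closure_UN_z_closure) auto
  finally show ?thesis .
qed

lemma ZId_map_closed:
  assumes \<phi>: "z_morphism S T \<phi>" and I: "I \<in> carrier (ZId S)"
  shows "ZId_map S T \<phi> I \<in> carrier (ZId T)"
proof -
  interpret T: csemiring T using \<phi> by (simp add: z_morphism_def)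
  have "I \<subseteq> carrier S" using I z_ideal_subset by (auto simp: ZId_def)
  then have "z_ideal T (z_closure T (\<phi> ` I))"
    by (intro T.z_ideal_z_closure z_morphism_image_subset[OF \<phi>])
  then show ?thesis by (simp add: ZId_map_eq[OF assms]) (simp add: ZId_def)
qed

lemma coherent_frame_hom_ZId_map:
  assumes \<phi>: "z_morphism S T \<phi>"
  shows "coherent_frame_hom (ZId S) (ZId T) (ZId_map S T \<phi>)"
proof -
  interpret S: csemiring S using \<phi> by (simp add: z_morphism_def)
  interpret T: csemiring T using \<phi> by (simp add: z_morphism_def)
  interpret LS: coherent_frame "ZId S" by (rule S.coherent_frame_ZId)
  interpret LT: coherent_frame "ZId T" by (rule T.coherent_frame_ZId)
  let ?h = "ZId_map S T \<phi>"
  have hom: "\<phi> \<in> ring_hom S T" using \<phi> by (simp add: z_morphism_def)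
  have sub: "I \<subseteq> carrier S" if "I \<in> carrier (ZId S)" for I
    using that z_ideal_subset by (auto simp: ZId_def)
  note im = z_morphism_image_subset[OF \<phi>]
  have closed: "?h I \<in> carrier (ZId T)" if "I \<in> carrier (ZId S)" for I
    using ZId_map_closed[OF \<phi> that] .
  \<comment> \<open>Direct images commute with unions. The inner closure is removed in the source by
    \<open>z_closure_image_z_closure\<close>, and closures of the individual images are inserted in
    the target by \<open>z_closure_UN_z_closure\<close>.\<close>
  have join: "?h (\<Squnion>\<^bsub>ZId S\<^esub>\<A>) = \<Squnion>\<^bsub>ZId T\<^esub>(?h ` \<A>)" if \<A>: "\<A> \<subseteq> carrier (ZId S)" for \<A>
  proof -
    have \<A>S: "\<Union>\<A> \<subseteq> carrier S" using \<A> sub by blast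
    have "?h (\<Squnion>\<^bsub>ZId S\<^esub>\<A>) = z_closure T (\<phi> ` z_closure S (\<Union>\<A>))"
      using ZId_map_eq[OF \<phi> LS.sup_closed[OF \<A>]] by (simp add: S.sup_ZId[OF \<A>])
    also have "\<dots> = z_closure T (\<Union>I\<in>\<A>. \<phi> ` I)"
      by (simp add: z_closure_image_z_closure[OF \<phi> \<A>S] image_Union)
    also have "\<dots> = z_closure T (\<Union>I\<in>\<A>. z_closure T (\<phi> ` I))"
      using \<A> sub im by (intro T.z_closure_UN_z_closure[symmetric]) blast
    also have "(\<Union>I\<in>\<A>. z_closure T (\<phi> ` I)) = \<Union>(?h ` \<A>)"
      using \<A> ZId_map_eq[OF \<phi>] by (intro SUP_cong) auto
    also have "z_closure T (\<Union>(?h ` \<A>)) = \<Squnion>\<^bsub>ZId T\<^esub>(?h ` \<A>)"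
      using \<A> closed by (intro T.sup_ZId[symmetric]) blast
    finally show ?thesis .
  qed
  have top: "?h \<top>\<^bsub>ZId S\<^esub> = \<top>\<^bsub>ZId T\<^esub>"
  proof -
    have z: "z_ideal T (z_closure T (\<phi> ` carrier S))"
      by (intro T.z_ideal_z_closure im) simp
    \<comment> \<open>The image contains the unit of \<open>T\<close>, and an ideal containing the
      unit is everything.\<close>
    have one: "\<one>\<^bsub>T\<^esub> \<in> z_closure T (\<phi> ` carrier S)"
      using ring_hom_one[OF hom] z_closure_extensive[of "\<phi> ` carrier S" T] S.one_closed
      by (metis imageI subsetD)
    have "carrier T \<subseteq> z_closure T (\<phi> ` carrier S)"
      using sr_ideal_mult[OF z_ideal_sr_ideal[OF z] _ one] by (metis T.r_one subsetI)
    then have "z_closure T (\<phi> ` carrier S) = carrier T"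
      using z_ideal_subset[OF z] by blast
    then show ?thesis
      using ZId_map_eq[OF \<phi> LS.top_closed] by (simp add: S.top_ZId T.top_ZId)
  qed
  have meet: "?h (I \<sqinter>\<^bsub>ZId S\<^esub> J) = ?h I \<sqinter>\<^bsub>ZId T\<^esub> ?h J"
    if I: "I \<in> carrier (ZId S)" and J: "J \<in> carrier (ZId S)" for I J
  proof -
    have zI: "z_ideal S I" and zJ: "z_ideal S J" using I J by (auto simp: ZId_def)
    let ?K = "z_closure T (\<phi> ` (I \<inter> J))"
    have K: "z_ideal T ?K" using sub[OF I] by (intro T.z_ideal_z_closure im) blast
    \<comment> \<open>A product of images is the image of a product, which lies in both
      \<open>I\<close> and \<open>J\<close>; this is the hypothesis required by
      \<open>z_closure_Int_subset\<close>.\<close>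
    have "u \<otimes>\<^bsub>T\<^esub> v \<in> ?K" if uv: "u \<in> \<phi> ` I" "v \<in> \<phi> ` J" for u v
    proof -
      obtain x y where xy: "x \<in> I" "y \<in> J" "u = \<phi> x" "v = \<phi> y" using uv by blast
      then have car: "x \<in> carrier S" "y \<in> carrier S" using sub I J by blast+
      have "x \<otimes>\<^bsub>S\<^esub> y \<in> I \<inter> J"
        using sr_ideal_mult[OF z_ideal_sr_ideal[OF zJ] car(1) xy(2)]
          S.sr_ideal_mult_right[OF z_ideal_sr_ideal[OF zI] xy(1) car(2)] by simp
      moreover have "u \<otimes>\<^bsub>T\<^esub> v = \<phi> (x \<otimes>\<^bsub>S\<^esub> y)" using ring_hom_mult[OF hom car] xy by simp
      ultimately show ?thesis using z_closure_extensive[of "\<phi> ` (I \<inter> J)" T] by blast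
    qed
    then have "z_closure T (\<phi> ` I) \<inter> z_closure T (\<phi> ` J) \<subseteq> ?K"
      using sub I J by (intro T.z_closure_Int_subset K im) auto
    moreover have "?K \<subseteq> z_closure T (\<phi> ` I)" "?K \<subseteq> z_closure T (\<phi> ` J)"
      by (intro z_closure_mono; blast)+
    ultimately have eq: "?K = z_closure T (\<phi> ` I) \<inter> z_closure T (\<phi> ` J)" by blast
    have "?h (I \<sqinter>\<^bsub>ZId S\<^esub> J) = ?K"
      using ZId_map_eq[OF \<phi> LS.meet_closed[OF I J]] by (simp add: S.meet_ZId[OF I J])
    moreover have "?h I \<sqinter>\<^bsub>ZId T\<^esub> ?h J = z_closure T (\<phi> ` I) \<inter> z_closure T (\<phi> ` J)"
      using T.meet_ZId[OF closed[OF I] closed[OF J]] by (simp add: ZId_map_eq[OF \<phi>] I J)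
    ultimately show ?thesis using eq by simp
  qed
  \<comment> \<open>A finite generating set of k is sent to a finite generating set of its
    image.\<close>
  have compact: "?h k \<in> compacts (ZId T)" if k: "k \<in> compacts (ZId S)" for k
  proof -
    obtain F where F: "finite F" "F \<subseteq> carrier S" "k = z_closure S F"
      using S.compact_obtain_finite[OF k] .
    have "?h k = z_closure T (\<phi> ` F)"
      using ZId_map_eq[OF \<phi>, of k] k F z_closure_image_z_closure[OF \<phi> F(2)]
      by (simp add: compacts_def)
    then show ?thesis using T.z_closure_finite_compact[of "\<phi> ` F"] F im by simp
  qed
  show ?thesis
    unfolding coherent_frame_hom_def frame_hom_def
    using S.frame_ZId T.frame_ZId S.coherent_frame_ZId T.coherent_frame_ZId
      closed join top meet compact by auto
qed

text \<open>Agreement of \<chi> with the composite is asked only on the carrier, so that both the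
  plain composite and its extensional restriction are covered.\<close>

lemma ZId_map_compose:
  assumes \<phi>: "z_morphism S T \<phi>" and \<psi>: "z_morphism T U \<psi>"
    and \<chi>: "z_morphism S U \<chi>" "\<And>x. x \<in> carrier S \<Longrightarrow> \<chi> x = \<psi> (\<phi> x)"
  shows "ZId_map S U \<chi> = compose (carrier (ZId S)) (ZId_map T U \<psi>) (ZId_map S T \<phi>)"
proof (rule extensionalityI[of _ "carrier (ZId S)"])
  show "ZId_map S U \<chi> \<in> extensional (carrier (ZId S))" by (simp add: ZId_map_def)
  show "compose (carrier (ZId S)) (ZId_map T U \<psi>) (ZId_map S T \<phi>) \<in> extensional (carrier (ZId S))"
    by simp
  fix I assume I: "I \<in> carrier (ZId S)"
  have sub: "I \<subseteq> carrier S" using I z_ideal_subset by (auto simp: ZId_def)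
  have im: "\<chi> ` I = \<psi> ` \<phi> ` I"
    unfolding image_image using \<chi>(2) sub by (intro image_cong) auto
  have "ZId_map T U \<psi> (ZId_map S T \<phi> I) = z_closure U (\<psi> ` z_closure T (\<phi> ` I))"
    using ZId_map_eq[OF \<psi> ZId_map_closed[OF \<phi> I]] by (simp add: ZId_map_eq[OF \<phi> I])
  also have "\<dots> = z_closure U (\<chi> ` I)"
    using z_closure_image_z_closure[OF \<psi> z_morphism_image_subset[OF \<phi> sub]] im by simp
  finally show "ZId_map S U \<chi> I = compose (carrier (ZId S)) (ZId_map T U \<psi>) (ZId_map S T \<phi>) I"
    using I by (simp add: compose_eq ZId_map_eq[OF \<chi>(1) I])
qed


section \<open>The categories of semirings and of coherent frames\<close>

text \<open>The preimage of a z-ideal along a composite is an iterated preimage, so the condition is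
  applied twice.\<close>

lemma z_morphism_comp:
  assumes \<phi>: "z_morphism S T \<phi>" and \<psi>: "z_morphism T U \<psi>"
    and \<chi>: "\<And>x. x \<in> carrier S \<Longrightarrow> \<chi> x = \<psi> (\<phi> x)"
  shows "z_morphism S U \<chi>"
  unfolding z_morphism_def
proof (intro conjI allI impI)
  interpret S: csemiring S using \<phi> by (simp add: z_morphism_def)
  show "csemiring S" "csemiring U" using \<phi> \<psi> by (simp_all add: z_morphism_def)
  have hom: "\<phi> \<in> ring_hom S T" "\<psi> \<in> ring_hom T U" using \<phi> \<psi> by (simp_all add: z_morphism_def)
  show "\<chi> \<in> ring_hom S U"
    using ring_hom_trans[OF hom]
    by (intro ring_hom_memI) (auto simp: \<chi> ring_hom_def)
  show "\<chi> \<zero>\<^bsub>S\<^esub> = \<zero>\<^bsub>U\<^esub>" using \<phi> \<psi> by (simp add: \<chi> z_morphism_def)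
  fix J assume J: "z_ideal U J"
  have "{x \<in> carrier S. \<phi> x \<in> {y \<in> carrier T. \<psi> y \<in> J}} = {x \<in> carrier S. \<chi> x \<in> J}"
    using ring_hom_closed[OF hom(1)] \<chi> by auto
  then show "z_ideal S {x \<in> carrier S. \<chi> x \<in> J}"
    using z_morphism_preimage[OF \<phi> z_morphism_preimage[OF \<psi> J]] by simp
qed

lemma z_morphism_id: "csemiring S \<Longrightarrow> z_morphism S S (\<lambda>x\<in>carrier S. x)"
proof -
  assume "csemiring S"
  then interpret S: csemiring S .
  have "{x \<in> carrier S. (\<lambda>x\<in>carrier S. x) x \<in> J} = J" if "z_ideal S J" for J
    using z_ideal_subset[OF that] by auto
  then show ?thesis
    unfolding z_morphism_def using S.csemiring_axioms by (auto intro!: ring_hom_memI)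
qed

lemma cat_category_CRigz: "cat_category CRigz"
proof
  fix A :: "'a ring" assume "A \<in> Obj CRigz"
  then show "Ide CRigz A \<in> Arr CRigz A A" by (simp add: CRigz_def z_morphism_id)
next
  fix A B D :: "'a ring" and f g
  assume "f \<in> Arr CRigz A B" "g \<in> Arr CRigz B D"
  then show "Cmp CRigz A B D g f \<in> Arr CRigz A D"
    by (auto simp: CRigz_def compose_eq intro: z_morphism_comp)
next
  fix A B :: "'a ring" and f assume "f \<in> Arr CRigz A B"
  \<comment> \<open>Extensionality of the arrow makes its composites with the restricted identities
    equal to it as functions on the whole type.\<close>
  then have f: "f \<in> extensional (carrier A)" "f \<in> carrier A \<rightarrow> carrier B"
    using z_morphism_image_subset[of A B f "carrier A"] by (auto simp: CRigz_def)
  show "Cmp CRigz A A B f (Ide CRigz A) = f" "Cmp CRigz A B B (Ide CRigz B) f = f"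
    using f by (auto simp: CRigz_def compose_Id Id_compose)
next
  fix A B D E :: "'a ring" and f g h assume "f \<in> Arr CRigz A B"
  then have f: "f \<in> carrier A \<rightarrow> carrier B"
    using z_morphism_image_subset[of A B f "carrier A"] by (auto simp: CRigz_def)
  show "Cmp CRigz A D E h (Cmp CRigz A B D g f) = Cmp CRigz A B E (Cmp CRigz B D E h g) f"
    using compose_assoc[OF f, of h g] by (simp add: CRigz_def)
qed

lemma coherent_frame_hom_closed: "coherent_frame_hom L M h \<Longrightarrow> h \<in> carrier L \<rightarrow> carrier M"
  by (simp add: coherent_frame_hom_def frame_hom_def)

lemma coherent_frame_hom_compose:
  assumes h: "coherent_frame_hom L M h" and k: "coherent_frame_hom M N k"
  shows "coherent_frame_hom L N (compose (carrier L) k h)"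
proof -
  interpret L: coherent_frame L using h by (simp add: coherent_frame_hom_def)
  note hc = coherent_frame_hom_closed[OF h] and kc = coherent_frame_hom_closed[OF k]
  have "compose (carrier L) k h (\<Squnion>\<^bsub>L\<^esub>A) = \<Squnion>\<^bsub>N\<^esub>(compose (carrier L) k h ` A)"
    if A: "A \<subseteq> carrier L" for A
  proof -
    have "h ` A \<subseteq> carrier M" using A hc by blast
    then have "k (h (\<Squnion>\<^bsub>L\<^esub>A)) = \<Squnion>\<^bsub>N\<^esub>(k ` h ` A)"
      using A h k by (simp add: coherent_frame_hom_def frame_hom_def)
    \<comment> \<open>The restriction in \<open>compose\<close> is invisible on subsets of the
      domain carrier.\<close>
    moreover have "compose (carrier L) k h ` A = k ` h ` A"
      unfolding image_image using A by (intro image_cong) (auto simp: compose_eq)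
    ultimately show ?thesis using A by (simp add: compose_eq)
  qed
  moreover have "compose (carrier L) k h ` compacts L \<subseteq> compacts N"
  proof -
    have "compose (carrier L) k h x = k (h x)" if "x \<in> compacts L" for x
      using that by (simp add: compacts_def compose_eq)
    then show ?thesis using h k unfolding coherent_frame_hom_def by auto
  qed
  moreover have "compose (carrier L) k h (x \<sqinter>\<^bsub>L\<^esub> y)
      = compose (carrier L) k h x \<sqinter>\<^bsub>N\<^esub> compose (carrier L) k h y"
    if "x \<in> carrier L" "y \<in> carrier L" for x y
    using that h k hc by (simp add: compose_eq coherent_frame_hom_def frame_hom_def Pi_iff)
  ultimately show ?thesis
    using h k hc kc funcset_compose[of h "carrier L" "carrier M" k "carrier N"]
    by (simp add: compose_eq coherent_frame_hom_def frame_hom_def)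
qed

lemma coherent_frame_hom_id:
  assumes "coherent_frame L"
  shows "coherent_frame_hom L L (\<lambda>x\<in>carrier L. x)"
proof -
  interpret coherent_frame L by fact
  have "(\<lambda>x\<in>carrier L. x) ` A = A" if "A \<subseteq> carrier L" for A
    using that by force
  moreover have "compacts L \<subseteq> carrier L" by (auto simp: compacts_def)
  ultimately show ?thesis
    unfolding coherent_frame_hom_def frame_hom_def using assms frame_axioms by simp
qed

lemma cat_category_CohFrm: "cat_category CohFrm"
proof
  fix A :: "'a gorder" assume "A \<in> Obj CohFrm"
  then show "Ide CohFrm A \<in> Arr CohFrm A A" by (simp add: CohFrm_def coherent_frame_hom_id)
next
  fix A B D :: "'a gorder" and f g
  assume "f \<in> Arr CohFrm A B" "g \<in> Arr CohFrm B D"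
  then show "Cmp CohFrm A B D g f \<in> Arr CohFrm A D"
    by (auto simp: CohFrm_def intro: coherent_frame_hom_compose)
next
  fix A B :: "'a gorder" and f assume "f \<in> Arr CohFrm A B"
  then have f: "f \<in> extensional (carrier A)" "f \<in> carrier A \<rightarrow> carrier B"
    using coherent_frame_hom_closed[of A B f] by (auto simp: CohFrm_def)
  show "Cmp CohFrm A A B f (Ide CohFrm A) = f" "Cmp CohFrm A B B (Ide CohFrm B) f = f"
    using f by (auto simp: CohFrm_def compose_Id Id_compose)
next
  fix A B D E :: "'a gorder" and f g h assume "f \<in> Arr CohFrm A B"
  then have f: "f \<in> carrier A \<rightarrow> carrier B"
    using coherent_frame_hom_closed[of A B f] by (auto simp: CohFrm_def)
  show "Cmp CohFrm A D E h (Cmp CohFrm A B D g f) = Cmp CohFrm A B E (Cmp CohFrm B D E h g) f"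
    using compose_assoc[OF f, of h g] by (simp add: CohFrm_def)
qed

section \<open>Functoriality of \<open>ZId\<close>\<close>

lemma cat_functor_ZId: "cat_functor CRigz CohFrm ZId ZId_map"
proof (rule cat_functor.intro[OF cat_category_CRigz cat_category_CohFrm], unfold_locales)
  fix A :: "'a ring" assume A: "A \<in> Obj CRigz"
  then show "ZId A \<in> Obj CohFrm"
    by (simp add: CRigz_def CohFrm_def csemiring.coherent_frame_ZId)
  have id: "z_morphism A A (\<lambda>x\<in>carrier A. x)" using A by (simp add: CRigz_def z_morphism_id)
  \<comment> \<open>The identity fixes each z-ideal as a set, and a z-ideal is its own closure;
    extensionality settles the values outside the carrier.\<close>
  have "ZId_map A A (\<lambda>x\<in>carrier A. x) = (\<lambda>I\<in>carrier (ZId A). I)"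
  proof (rule extensionalityI[of _ "carrier (ZId A)"])
    show "ZId_map A A (\<lambda>x\<in>carrier A. x) \<in> extensional (carrier (ZId A))"
      by (simp add: ZId_map_def)
    fix I assume I: "I \<in> carrier (ZId A)"
    then have zI: "z_ideal A I" by (simp add: ZId_def)
    then have "(\<lambda>x\<in>carrier A. x) ` I = I" using z_ideal_subset by force
    then show "ZId_map A A (\<lambda>x\<in>carrier A. x) I = (\<lambda>I\<in>carrier (ZId A). I) I"
      using I zI by (simp add: ZId_map_eq[OF id I] z_closure_z_ideal_eq)
  qed simp
  then show "ZId_map A A (Ide CRigz A) = Ide CohFrm (ZId A)"
    by (simp add: CRigz_def CohFrm_def)
next
  fix A B :: "'a ring" and f assume "f \<in> Arr CRigz A B"
  then show "ZId_map A B f \<in> Arr CohFrm (ZId A) (ZId B)"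
    by (simp add: CRigz_def CohFrm_def coherent_frame_hom_ZId_map) (simp add: ZId_map_def)
next
  fix A B E :: "'a ring" and f g assume "f \<in> Arr CRigz A B" "g \<in> Arr CRigz B E"
  then have f: "z_morphism A B f" and g: "z_morphism B E g" by (auto simp: CRigz_def)
  have "ZId_map A E (compose (carrier A) g f)
      = compose (carrier (ZId A)) (ZId_map B E g) (ZId_map A B f)"
    by (intro ZId_map_compose[OF f g] z_morphism_comp[OF f g]) (simp_all add: compose_eq)
  then show "ZId_map A E (Cmp CRigz A B E g f)
      = Cmp CohFrm (ZId A) (ZId B) (ZId E) (ZId_map B E g) (ZId_map A B f)"
    by (simp add: CRigz_def CohFrm_def)
qed

text \<open>Arrows of \<open>CRigz\<close> are functions from one type to itself, so the functor
  lives over a single type. The first two conjuncts therefore state the homomorphism property and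
  the composition law for carriers in different types.\<close>

theorem proposition10p2:
  shows
    "(\<forall>(S :: 'a ring) (T :: 'b ring) \<phi>. z_morphism S T \<phi> \<longrightarrow>
        coherent_frame_hom (ZId S) (ZId T) (ZId_map S T \<phi>)) \<and>
     (\<forall>(S :: 'a ring) (T :: 'b ring) (U :: 'c ring) \<phi> \<psi>.
        z_morphism S T \<phi> \<and> z_morphism T U \<psi> \<longrightarrow>
        ZId_map S U (\<psi> \<circ> \<phi>) = compose (carrier (ZId S)) (ZId_map T U \<psi>) (ZId_map S T \<phi>)) \<and>
     cat_functor (CRigz :: ('d ring, 'd \<Rightarrow> 'd) cat) CohFrm ZId ZId_map"
proof (intro conjI allI impI)
  fix S :: "'a ring" and T :: "'b ring" and U :: "'c ring" and \<phi> \<psi>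
  assume "z_morphism S T \<phi> \<and> z_morphism T U \<psi>"
  then have \<phi>: "z_morphism S T \<phi>" and \<psi>: "z_morphism T U \<psi>" by auto
  show "ZId_map S U (\<psi> \<circ> \<phi>) = compose (carrier (ZId S)) (ZId_map T U \<psi>) (ZId_map S T \<phi>)"
    by (intro ZId_map_compose[OF \<phi> \<psi>] z_morphism_comp[OF \<phi> \<psi>]) simp_all
qed (simp_all add: coherent_frame_hom_ZId_map cat_functor_ZId)

end
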